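(* Let $\mathbb{X},\mathbb{Y}$ be finite-dimensional real inner product spaces, let $\mathcal{K}\subset\mathbb{X}$ be a symmetric cone, and let $M:\mathbb{X}\to\mathbb{Y}$ be a linear mapping with $\operatorname{rank}(M)=r$. Put $\hat{\mathcal{K}}:=M\mathcal{K}=\{Mx: x\in\mathcal{K}\}$. If $\operatorname{Ker}(M)\cap\operatorname{int}(\mathcal{K})\neq\emptyset$, then $\hat{\mathcal{K}}=\operatorname{Im}(M)\simeq\mathbb{R}^r$. In particular, $\hat{\mathcal{K}}$ is closed.
   Context: A symmetric cone is a closed convex cone with nonempty interior that is self-dual and homogeneous (its linear automorphism group acts transitively on its interior). $\operatorname{int}$ denotes the topological interior in $\mathbb{X}$, $\operatorname{Ker}(M)$ the kernel and $\operatorname{Im}(M)$ the range of $M$. The symbol $\simeq$ denotes isomorphism of vector spaces. *)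

theory Defs
  imports "HOL-Analysis.Analysis"
begin

definition dual_cone :: "'a::real_inner set \<Rightarrow> 'a set" where
  "dual_cone K = {y. \<forall>x\<in>K. 0 \<le> x \<bullet> y}"

definition linear_automorphisms :: "'a::real_vector set \<Rightarrow> ('a \<Rightarrow> 'a) set" where
  "linear_automorphisms K = {A. linear A \<and> bij A \<and> A ` K = K}"

definition homogeneous_cone :: "'a::real_inner set \<Rightarrow> bool" where
  "homogeneous_cone K \<longleftrightarrow>
     (\<forall>x\<in>interior K. \<forall>y\<in>interior K. \<exists>A\<in>linear_automorphisms K. A x = y)"

definition symmetric_cone :: "'a::real_inner set \<Rightarrow> bool" where
  "symmetric_cone K \<longleftrightarrow>
     closed K \<and> convex K \<and> cone K \<and> interior K \<noteq> {} \<and>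
     dual_cone K = K \<and> homogeneous_cone K"

definition Ker :: "('a::real_vector \<Rightarrow> 'b::real_vector) \<Rightarrow> 'a set" where
  "Ker M = {x. M x = 0}"

(* The dimension n is a term, so R^n is the set of real functions on {..<n}, taken as
   extensional functions (value undefined outside {..<n}) so that equality in R^n is
   equality of the n coordinates. The vector operations of R^n are the coordinatewise ones. *)
definition Rn :: "nat \<Rightarrow> (nat \<Rightarrow> real) set" where
  "Rn n = {..<n} \<rightarrow>\<^sub>E UNIV"

definition isomorphic_Rn :: "'b::real_vector set \<Rightarrow> nat \<Rightarrow> bool" where
  "isomorphic_Rn V n \<longleftrightarrow> subspace V \<and>
     (\<exists>\<phi>. bij_betw \<phi> V (Rn n) \<and>
          (\<forall>x\<in>V. \<forall>y\<in>V. \<forall>i<n. \<phi> (x + y) i = \<phi> x i + \<phi> y i) \<and>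
          (\<forall>c. \<forall>x\<in>V. \<forall>i<n. \<phi> (c *\<^sub>R x) i = c * \<phi> x i))"

end

theory Submission
  imports Defs
begin

text \<open>Around a kernel point \<open>x0\<close> interior to \<open>K\<close> there is room to
  move a little in every direction: \<open>x0 + t *\<^sub>R x\<close> lies in \<open>K\<close> for
  small t > 0, and \<open>M\<close> sends it to t times \<open>M x\<close>. Rescaling inside the
  cone puts \<open>M x\<close> in the image, so the image is the whole range
  (\<open>linear_image_cone_eq_range\<close>). The range is the span of a finite basis with r
  elements, whose coordinates identify it with R^r (\<open>isomorphic_Rn_span\<close>); such a span
  is closed (\<open>closed_span_finite\<close>).\<close>

text \<open>The span is the fixed-point set of the orthogonal projection onto it, a continuous map
  given by an explicit finite sum.\<close>

lemma closed_span_finite: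
  fixes B :: "'a::real_inner set"
  assumes "finite B"
  shows "closed (span B)"
proof -
  obtain C where C: "finite C" "span C = span B" "pairwise orthogonal C"
    using basis_orthogonal[OF assms] by blast
  define p where "p x = (\<Sum>c\<in>C. (c \<bullet> x / (c \<bullet> c)) *\<^sub>R c)" for x
  have p_in: "p x \<in> span C" for x
    unfolding p_def by (intro span_sum span_scale span_base)
  have lin: "linear p"
    by (auto simp: p_def inner_add_right add_divide_distrib scaleR_left_distrib
        sum.distrib scaleR_sum_right intro!: linearI)
  have p_base: "p b = b" if "b \<in> C" for b
  proof -
    \<comment> \<open>Orthogonality kills the terms with c \<noteq> b. The set \<open>C\<close> may
      contain 0, which is harmless: for b = 0 the remaining term is a multiple of 0.\<close>
    have "p b = (\<Sum>c\<in>C. if c = b then b else 0)"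
      unfolding p_def using C(3) that
      by (intro sum.cong refl) (auto simp: pairwise_def orthogonal_def)
    then show ?thesis using C(1) that by simp
  qed
  have "p x = x" if "x \<in> span C" for x
    using that by (induction rule: span_induct_alt)
      (auto simp: linear_0[OF lin] linear_add[OF lin] linear_scale[OF lin] p_base)
  with p_in have "span B = {x. p x = x}"
    unfolding C(2)[symmetric] by (auto, metis)
  moreover have "closed {x. p x = x}"
    unfolding p_def divide_inverse by (intro closed_Collect_eq continuous_intros)
  ultimately show ?thesis by simp
qed

lemma isomorphic_Rn_span:
  fixes B :: "'b::real_vector set"
  assumes fin: "finite B" and ind: "independent B"
  shows "isomorphic_Rn (span B) (card B)"
proof -
  obtain h where h: "bij_betw h {..<card B} B"
    using ex_bij_betw_nat_finite[OF fin] by (auto simp: atLeast0LessThan)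
  \<comment> \<open>Coordinates in the basis enumerated by \<open>h\<close>, with inverse
    \<open>\<psi>\<close>. The restricted lambda is \<open>undefined\<close> from
    \<open>card B\<close> on, as membership in \<open>Rn\<close> demands.\<close>
  define \<phi> where "\<phi> x = (\<lambda>i\<in>{..<card B}. representation B x (h i))" for x
  define \<psi> where "\<psi> f = (\<Sum>i<card B. f i *\<^sub>R h i)" for f :: "nat \<Rightarrow> real"
  have hB: "h i \<in> B" if "i < card B" for i
    using h that by (auto simp: bij_betw_def)
  have \<psi>_in: "\<psi> f \<in> span B" for f
    unfolding \<psi>_def by (intro span_sum span_scale span_base hB) simp
  have \<phi>_in: "\<phi> x \<in> Rn (card B)" for x
    by (simp add: \<phi>_def Rn_def restrict_PiE_iff)
  have "\<psi> (\<phi> x) = x" if "x \<in> span B" for x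
  proof -
    have "\<psi> (\<phi> x) = (\<Sum>i<card B. representation B x (h i) *\<^sub>R h i)"
      by (simp add: \<psi>_def \<phi>_def)
    also have "\<dots> = (\<Sum>b\<in>B. representation B x b *\<^sub>R b)"
      by (rule sum.reindex_bij_betw[OF h])
    also have "\<dots> = x"
      by (rule real_vector.sum_representation_eq[OF ind that fin]) simp
    finally show ?thesis .
  qed
  moreover have "\<phi> (\<psi> f) = f" if f: "f \<in> Rn (card B)" for f
  proof
    fix j
    show "\<phi> (\<psi> f) j = f j"
    proof (cases "j < card B")
      case True
      have hs: "h i \<in> span B" if "i \<in> {..<card B}" for i
        using that by (intro span_base hB) simp
      have "representation B (\<psi> f) (h j)
          = (\<Sum>i<card B. representation B (f i *\<^sub>R h i) (h j))"
        unfolding \<psi>_def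
        by (subst real_vector.representation_sum[OF ind]) (auto intro: span_scale hs)
      also have "\<dots> = (\<Sum>i<card B. f i * representation B (h i) (h j))"
        by (intro sum.cong refl)
          (subst real_vector.representation_scale[OF ind hs], simp_all)
      \<comment> \<open>A basis vector has indicator coordinates, and injectivity of
        \<open>h\<close> turns equality of vectors into equality of indices.\<close>
      also have "\<dots> = (\<Sum>i<card B. if i = j then f j else 0)"
        using hB h True
        by (intro sum.cong refl)
          (auto simp: real_vector.representation_basis[OF ind] bij_betw_def inj_on_def)
      also have "\<dots> = f j"
        using True by simp
      finally show ?thesis
        using True by (simp add: \<phi>_def)
    next
      case False
      then show ?thesis
        using f by (auto simp: \<phi>_def Rn_def PiE_def extensional_def)
    qed
  qed
  ultimately have "bij_betw \<phi> (span B) (Rn (card B))"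
    using \<psi>_in \<phi>_in by (intro bij_betw_byWitness[where f' = \<psi>]) auto
  then show ?thesis
    unfolding isomorphic_Rn_def
    by (intro conjI exI[of _ \<phi>])
      (auto simp: \<phi>_def real_vector.representation_add[OF ind]
        real_vector.representation_scale[OF ind])
qed

lemma linear_image_cone_eq_range:
  fixes M :: "'a::real_normed_vector \<Rightarrow> 'b::real_vector"
  assumes lin: "linear M" and K: "cone K" and meets: "Ker M \<inter> interior K \<noteq> {}"
  shows "M ` K = range M"
proof -
  obtain x0 e where x0: "M x0 = 0" and e: "e > 0" "cball x0 e \<subseteq> K"
    using meets by (auto simp: Ker_def mem_interior_cball)
  have "M x \<in> M ` K" for x
  proof
    \<comment> \<open>Small enough that the step from \<open>x0\<close> along \<open>x\<close> stays
      within the ball of radius \<open>e\<close>; the 1 keeps the denominator positive at x =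
      0.\<close>
    define t where "t = e / (norm x + 1)"
    have t: "t > 0" "t * norm x \<le> e"
      using e(1) by (auto simp: t_def field_simps add_pos_nonneg add_nonneg_pos)
    then have "x0 + t *\<^sub>R x \<in> K"
      using e(2) by (auto simp: dist_norm)
    \<comment> \<open>This preimage differs from \<open>x\<close> by a multiple of
      \<open>x0\<close>, which \<open>M\<close> annihilates.\<close>
    then show "(1 / t) *\<^sub>R (x0 + t *\<^sub>R x) \<in> K"
      using K t(1) by (intro mem_cone) auto
    show "M x = M ((1 / t) *\<^sub>R (x0 + t *\<^sub>R x))"
      using t(1) by (simp add: linear_scale[OF lin] linear_add[OF lin] x0)
  qed
  then show ?thesis by blast
qed

theorem proposition2p7:
  fixes M :: "'a::real_inner \<Rightarrow> 'b::real_inner"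
    and K :: "'a set"
    and r :: nat
  assumes finite_dim_X: "\<exists>B::'a set. finite_dimensional_vector_space (*\<^sub>R) B"
    and finite_dim_Y: "\<exists>B::'b set. finite_dimensional_vector_space (*\<^sub>R) B"
    and symmetric: "symmetric_cone K"
    and linear: "linear M"
    and rank: "dim (range M) = r"
    and meets: "Ker M \<inter> interior K \<noteq> {}"
  shows "M ` K = range M \<and> isomorphic_Rn (range M) r \<and> closed (M ` K)"
proof -
  obtain D :: "'b set" where "finite_dimensional_vector_space (*\<^sub>R) D"
    using finite_dim_Y by blast
  then have D: "finite D" "span D = UNIV"
    using finite_dimensional_vector_space.finite_Basis
      finite_dimensional_vector_space.span_Basis
    unfolding span_raw_def by blast+
  have sub: "subspace (range M)"
    using linear by (rule linear_subspace_image) simp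
  obtain B where B: "B \<subseteq> range M" "independent B" "range M \<subseteq> span B" "card B = r"
    using basis_exists[of "range M"] rank by metis
  \<comment> \<open>Infinite sets have \<open>card\<close> 0, so \<open>card B = r\<close> does not
    settle finiteness when r = 0; the finite spanning set \<open>D\<close> of the codomain
    does.\<close>
  have fin: "finite B"
    using independent_span_bound[OF D(1) B(2)] D(2) by simp
  have span: "span B = range M"
    using B(1,3) sub by (simp add: span_minimal subset_antisym)
  have "M ` K = range M"
    using linear_image_cone_eq_range[OF linear _ meets] symmetric
    by (simp add: symmetric_cone_def)
  then show ?thesis
    using isomorphic_Rn_span[OF fin B(2)] closed_span_finite[OF fin]
    by (simp add: span B(4))
qed

end
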